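(* Fix a prime power $q$. For each $n\geq 1$ let $\pi_n$ be a random set partition of $[n]$ distributed according to the superplancherel measure $\mathrm{SPl}_n$ (all $\pi_n$ being defined on a common probability space). Then $\mu_{\pi_n}\to\Omega$ almost surely, where the convergence is weak* convergence of measures.
   Context: Set partitions. $[n]=\{1,\dots,n\}$; $\pi\vdash[n]$ means that $\pi$ is a set partition of $[n]$. A pair $(i,j)$ with $i<j$ is an arc of $\pi$ if $i,j$ lie in the same block of $\pi$ and no $k$ with $i<k<j$ lies in that block. $D(\pi)$ is the set of arcs, $d(\pi)=|D(\pi)|$, $\dim(\pi)=\sum_{(i,j)\in D(\pi)}(j-i)$, and $\mathrm{crs}(\pi)$ is the number of crossings, i.e. unordered pairs of arcs $\{(i,j),(k,l)\}\subseteq D(\pi)$ with $i<k<j<l$. Superplancherel measure. Let $U_n$ be the group of $n\times n$ upper unitriangular matrices over the field with $q$ elements, $|U_n|=q^{n(n-1)/2}$. In the supercharacter theory of $U_n$ due to Bergeron and Thiem, the supercharacters $\chi^\pi$ are indexed by $\pi\vdash[n]$ and satisfy $\chi^\pi(1)=(q-1)^{d(\pi)}q^{\dim(\pi)-d(\pi)}$ and $\langle\chi^\pi,\chi^\pi\rangle=(q-1)^{d(\pi)}q^{\mathrm{crs}(\pi)}$. The superplancherel measure is the probability measure on set partitions of $[n]$ (equivalently on the supercharacters) given by $$\mathrm{SPl}_n(\pi)=\frac{1}{|U_n|}\frac{\chi^\pi(1)^2}{\langle\chi^\pi,\chi^\pi\rangle}=\frac{1}{q^{n(n-1)/2}}\,\frac{(q-1)^{d(\pi)}q^{2\dim(\pi)-2d(\pi)}}{q^{\mathrm{crs}(\pi)}}.$$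 Measures. $\Delta=\{(x,y)\in[0,1]^2: y\ge x\}$. For $i<j\le n$, $A_{i,j}=[\frac{i-1}{n},\frac in]\times[\frac{j-1}{n},\frac jn]$ and $\lambda_{A_{i,j}}$ is the uniform probability measure on $A_{i,j}$. For $\pi\vdash[n]$, $\mu_\pi=\frac1n\sum_{(i,j)\in D(\pi)}\lambda_{A_{i,j}}$, a measure on $\Delta$ of total mass at most $1$. $\Omega$ is the uniform measure of total mass $1/2$ on the segment $\{(x,1-x):x\in[0,1/2]\}$, i.e. the push-forward of Lebesgue measure on $[0,1/2]$ under $x\mapsto(x,1-x)$. Weak* convergence $\mu_n\to\mu$ means $\int f\,d\mu_n\to\int f\,d\mu$ for every bounded continuous $f:\Delta\to\mathbb{R}$. *)

theory Defs
  imports "HOL-Probability.Probability" "HOL-Number_Theory.Prime_Powers"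
begin

section \<open>Statistics of set partitions\<close>

definition set_partitions :: "nat \<Rightarrow> nat set set set" where
  "set_partitions n = {\<pi>. partition_on {1..n} \<pi>}"

definition arcs :: "nat set set \<Rightarrow> (nat \<times> nat) set" where
  "arcs \<pi> = {(i, j). i < j \<and> (\<exists>B\<in>\<pi>. i \<in> B \<and> j \<in> B \<and> (\<forall>k. i < k \<and> k < j \<longrightarrow> k \<notin> B))}"

definition num_arcs :: "nat set set \<Rightarrow> nat" where
  "num_arcs \<pi> = card (arcs \<pi>)"

definition dimension :: "nat set set \<Rightarrow> nat" where
  "dimension \<pi> = (\<Sum>(i, j)\<in>arcs \<pi>. j - i)"

definition crossings :: "nat set set \<Rightarrow> (nat \<times> nat) set set" where
  "crossings \<pi> =
     {{(i, j), (k, l)} | i j k l.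
        (i, j) \<in> arcs \<pi> \<and> (k, l) \<in> arcs \<pi> \<and> i < k \<and> k < j \<and> j < l}"

definition crs :: "nat set set \<Rightarrow> nat" where
  "crs \<pi> = card (crossings \<pi>)"

lemma arcs_subset:
  assumes "\<pi> \<in> set_partitions n" "(i, j) \<in> arcs \<pi>"
  shows "1 \<le> i" "i < j" "j \<le> n"
  using assms by (auto simp: set_partitions_def partition_on_def arcs_def)

lemma finite_arcs:
  assumes "\<pi> \<in> set_partitions n"
  shows "finite (arcs \<pi>)"
proof (rule finite_subset)
  show "arcs \<pi> \<subseteq> {1..n} \<times> {1..n}"
    using arcs_subset[OF assms] by force
qed simp

text \<open>The truncated subtraction in the exponents below is harmless.\<close>

lemma num_arcs_le_dimension: "num_arcs \<pi> \<le> dimension \<pi>"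
proof -
  have "num_arcs \<pi> = (\<Sum>(i, j)\<in>arcs \<pi>. 1)"
    by (simp add: num_arcs_def)
  also have "\<dots> \<le> dimension \<pi>"
    unfolding dimension_def by (rule sum_mono) (auto simp: arcs_def)
  finally show ?thesis .
qed

section \<open>The superplancherel measure\<close>

text \<open>Degree \<open>\<chi>\<^sup>\<pi>(1)\<close> and squared norm \<open>\<langle>\<chi>\<^sup>\<pi>, \<chi>\<^sup>\<pi>\<rangle>\<close> of the supercharacter indexed by \<open>\<pi>\<close>
  in the supercharacter theory of Bergeron and Thiem, given by their closed formulas.\<close>

definition superchar_degree :: "nat \<Rightarrow> nat set set \<Rightarrow> real" where
  "superchar_degree q \<pi> = (real q - 1) ^ num_arcs \<pi> * real q ^ (dimension \<pi> - num_arcs \<pi>)"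

definition superchar_norm :: "nat \<Rightarrow> nat set set \<Rightarrow> real" where
  "superchar_norm q \<pi> = (real q - 1) ^ num_arcs \<pi> * real q ^ crs \<pi>"

definition unitriangular_order :: "nat \<Rightarrow> nat \<Rightarrow> nat" where
  "unitriangular_order q n = q ^ (n * (n - 1) div 2)"

definition SPl :: "nat \<Rightarrow> nat \<Rightarrow> nat set set \<Rightarrow> real" where
  "SPl q n \<pi> =
     1 / real (unitriangular_order q n) * ((superchar_degree q \<pi>)\<^sup>2 / superchar_norm q \<pi>)"

lemma SPl_eq:
  assumes "1 < q"
  shows "SPl q n \<pi> =
     1 / real q ^ (n * (n - 1) div 2) *
       ((real q - 1) ^ num_arcs \<pi> * real q ^ (2 * dimension \<pi> - 2 * num_arcs \<pi>) / real q ^ crs \<pi>)"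
  using assms
  by (simp add: SPl_def unitriangular_order_def superchar_degree_def superchar_norm_def
      power_mult_distrib power2_eq_square field_simps flip: power_add mult_2 diff_mult_distrib2)

definition superplancherel :: "nat \<Rightarrow> nat \<Rightarrow> nat set set measure" where
  "superplancherel q n = point_measure (set_partitions n) (\<lambda>\<pi>. ennreal (SPl q n \<pi>))"

section \<open>Measures on the triangle\<close>

definition upper_triangle :: "(real \<times> real) set" where
  "upper_triangle = {(x, y). x \<in> {0..1} \<and> y \<in> {0..1} \<and> x \<le> y}"

definition cell :: "nat \<Rightarrow> nat \<Rightarrow> nat \<Rightarrow> (real \<times> real) set" where
  "cell n i j = {(real i - 1) / n .. real i / n} \<times> {(real j - 1) / n .. real j / n}"

definition partition_measure :: "nat \<Rightarrow> nat set set \<Rightarrow> (real \<times> real) measure" where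
  "partition_measure n \<pi> =
     measure_of upper_triangle (sets (restrict_space borel upper_triangle))
       (\<lambda>S. ennreal (1 / n) * (\<Sum>(i, j)\<in>arcs \<pi>. emeasure (uniform_measure lborel (cell n i j)) S))"

definition Omega :: "(real \<times> real) measure" where
  "Omega = distr (restrict_space lborel {0..1/2}) (restrict_space borel upper_triangle) (\<lambda>x. (x, 1 - x))"

definition weak_star_convergent ::
    "(nat \<Rightarrow> (real \<times> real) measure) \<Rightarrow> (real \<times> real) measure \<Rightarrow> bool" where
  "weak_star_convergent N L \<longleftrightarrow>
     (\<forall>f :: real \<times> real \<Rightarrow> real. continuous_on upper_triangle f \<and> bounded (f ` upper_triangle) \<longrightarrow>
        (\<lambda>n. \<integral>z. f z \<partial>N n) \<longlonglongrightarrow> (\<integral>z. f z \<partial>L))"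

lemma closed_upper_triangle: "closed upper_triangle"
proof -
  have eq: "upper_triangle = {0..1} \<times> {0..1} \<inter> {z. fst z \<le> snd z}"
    by (auto simp: upper_triangle_def)
  show ?thesis
    unfolding eq
    by (intro closed_Int closed_Times closed_atLeastAtMost closed_Collect_le continuous_intros)
qed

lemma upper_triangle_borel [measurable]: "upper_triangle \<in> sets borel"
  using closed_upper_triangle by simp

lemma antidiagonal_measurable:
  "(\<lambda>x :: real. (x, 1 - x)) \<in>
     restrict_space lborel {0..1/2} \<rightarrow>\<^sub>M restrict_space borel upper_triangle"
proof (rule measurable_restrict_space2)
  show "(\<lambda>x :: real. (x, 1 - x)) \<in> restrict_space lborel {0..1/2} \<rightarrow>\<^sub>M borel"
    by (intro measurable_restrict_space1) simp
qed (auto simp: upper_triangle_def space_restrict_space)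

text \<open>The cells of arcs lie in the triangle, so that restricting the uniform measures
  to it loses no mass.\<close>

lemma cell_subset_upper_triangle:
  assumes "1 \<le> i" "i < j" "j \<le> n"
  shows "cell n i j \<subseteq> upper_triangle"
proof
  fix z assume "z \<in> cell n i j"
  then obtain x y where z: "z = (x, y)"
    and x: "(real i - 1) / n \<le> x" "x \<le> real i / n"
    and y: "(real j - 1) / n \<le> y" "y \<le> real j / n"
    by (auto simp: cell_def)
  have "0 \<le> (real i - 1) / n" "real i / n \<le> (real j - 1) / n" "real j / n \<le> 1"
    using assms by (auto simp: divide_right_mono)
  then show "z \<in> upper_triangle"
    using x y by (auto simp: z upper_triangle_def)
qed

lemma space_partition_measure [simp]: "space (partition_measure n \<pi>) = upper_triangle"
  unfolding partition_measure_def
  by (rule space_measure_of) (auto simp: sets_restrict_space)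

lemma sets_partition_measure [simp, measurable_cong]:
  "sets (partition_measure n \<pi>) = sets (restrict_space borel upper_triangle)"
  unfolding partition_measure_def
  using sets.sets_measure_of_eq[of "restrict_space borel upper_triangle"]
  by (simp add: space_restrict_space)

lemma emeasure_partition_measure:
  assumes "S \<in> sets (restrict_space borel upper_triangle)"
  shows "emeasure (partition_measure n \<pi>) S =
    ennreal (1 / n) * (\<Sum>(i, j)\<in>arcs \<pi>. emeasure (uniform_measure lborel (cell n i j)) S)"
proof (rule emeasure_measure_of[OF partition_measure_def])
  show "sets (restrict_space borel upper_triangle) \<subseteq> Pow upper_triangle"
    by (auto simp: sets_restrict_space)
  show "positive (sets (partition_measure n \<pi>))
     (\<lambda>S. ennreal (1 / n) * (\<Sum>(i, j)\<in>arcs \<pi>. emeasure (uniform_measure lborel (cell n i j)) S))"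
    by (simp add: positive_def case_prod_beta)
  show "countably_additive (sets (partition_measure n \<pi>))
     (\<lambda>S. ennreal (1 / n) * (\<Sum>(i, j)\<in>arcs \<pi>. emeasure (uniform_measure lborel (cell n i j)) S))"
  proof (rule countably_additiveI)
    fix A :: "nat \<Rightarrow> (real \<times> real) set"
    assume A: "range A \<subseteq> sets (partition_measure n \<pi>)" "disjoint_family A"
    then have "range A \<subseteq> sets lborel"
      by (auto simp: sets_restrict_space)
    then have "(\<Sum>k. emeasure (uniform_measure lborel (cell n i j)) (A k)) =
        emeasure (uniform_measure lborel (cell n i j)) (\<Union>k. A k)" for i j
      using A by (intro suminf_emeasure) auto
    then show "(\<Sum>k. ennreal (1 / n) *
          (\<Sum>(i, j)\<in>arcs \<pi>. emeasure (uniform_measure lborel (cell n i j)) (A k))) =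
        ennreal (1 / n) *
          (\<Sum>(i, j)\<in>arcs \<pi>. emeasure (uniform_measure lborel (cell n i j)) (\<Union>k. A k))"
      by (simp add: case_prod_beta suminf_sum)
  qed
qed (use assms in simp)

end

theory Submission
  imports Defs "HOL-Real_Asymp.Real_Asymp"
begin

text \<open>The weight of \<open>\<pi>\<close> is at most \<open>q\<close> to the power \<open>- \<delta>(\<pi>)\<close>, where
  \<open>\<delta>(\<pi>) = crs(\<pi>) + n(n-1)/2 - 2 dim(\<pi>)\<close>, and there are at most \<open>n\<^sup>n\<close> partitions, which is negligible
  against \<open>2\<close> to the power \<open>n\<^bsup>3/2\<^esup>\<close>. By Borel-Cantelli, almost surely
  \<open>\<delta>(\<pi>\<^sub>n) \<le> n\<^bsup>3/2\<^esup> = o(n\<^sup>2)\<close> eventually, and the rest is deterministic.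

  Up to \<open>O(n)\<close>, \<open>n\<^sup>2/4 - dim(\<pi>)\<close> bounds the total distance to \<open>n/2\<close> of the points on the wrong side:
  those up to \<open>n/2\<close> that are not left ends of arcs or beyond \<open>n/2\<close> that are, and likewise for right ends. So
  if \<open>\<delta>(\<pi>) = o(n\<^sup>2)\<close>, only \<open>o(n)\<close> points are misplaced and \<open>crs(\<pi>) = o(n\<^sup>2)\<close>. For an
  arc \<open>(i, j)\<close> with \<open>i \<le> n/2 < j\<close>, counting the arcs that cross, enclose or are enclosed by it gives
  \<open>\<bar>n + 1 - i - j\<bar> \<le> o(n) + #{arcs crossing (i, j)}\<close>. Summing, the arcs are on average within
  \<open>o(n)\<close> of the antidiagonal, and almost every \<open>i \<le> n/2\<close> starts one.\<close>

section \<open>Partitions of nearly maximal dimension\<close>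

text \<open>Blocks are disjoint, so two arcs leaving \<open>i\<close> lie in the same block, and the
  right end of each is the successor of \<open>i\<close> in it.\<close>

lemma inj_on_fst_arcs:
  assumes "\<pi> \<in> set_partitions n"
  shows "inj_on fst (arcs \<pi>)"
proof -
  have *: "j \<le> j'" if arcs: "(i, j) \<in> arcs \<pi>" "(i, j') \<in> arcs \<pi>" for i j j'
  proof -
    from arcs obtain B B' where B: "B \<in> \<pi>" "i \<in> B" "j \<in> B" "\<forall>k. i < k \<and> k < j \<longrightarrow> k \<notin> B"
      and B': "B' \<in> \<pi>" "i \<in> B'" "j' \<in> B'" "i < j'"
      by (auto simp: arcs_def)
    have "B = B'"
      using assms B B' unfolding set_partitions_def partition_on_def disjoint_def by blast
    then show ?thesis using B B' by (meson not_le)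
  qed
  show ?thesis
    by (auto simp: inj_on_def) (metis * order_antisym)
qed

lemma inj_on_snd_arcs:
  assumes "\<pi> \<in> set_partitions n"
  shows "inj_on snd (arcs \<pi>)"
proof -
  have *: "i \<le> i'" if arcs: "(i, j) \<in> arcs \<pi>" "(i', j) \<in> arcs \<pi>" for i i' j
  proof -
    from arcs obtain B B' where B: "B \<in> \<pi>" "i \<in> B" "j \<in> B" "i < j"
      and B': "B' \<in> \<pi>" "i' \<in> B'" "j \<in> B'" "\<forall>k. i' < k \<and> k < j \<longrightarrow> k \<notin> B'"
      by (auto simp: arcs_def)
    have "B = B'"
      using assms B B' unfolding set_partitions_def partition_on_def disjoint_def by blast
    then show ?thesis using B B' by (meson not_le)
  qed
  show ?thesis
    by (auto simp: inj_on_def) (metis * order_antisym)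
qed

section \<open>Misplaced ends and the loss of dimension\<close>

text \<open>The reference position puts the left ends exactly in the lower half and the right ends
  exactly in the upper half; the middle point of an odd \<open>n\<close> belongs to the upper one.
  As left and right ends are equally many, an odd \<open>n\<close> always has a misplaced
  point.\<close>

definition misplaced_left :: "nat \<Rightarrow> nat set set \<Rightarrow> nat set" where
  "misplaced_left n \<pi> = {i \<in> {1..n}. (i \<in> fst ` arcs \<pi>) \<noteq> (i \<in> {1..n div 2})}"

definition misplaced_right :: "nat \<Rightarrow> nat set set \<Rightarrow> nat set" where
  "misplaced_right n \<pi> = {j \<in> {1..n}. (j \<in> snd ` arcs \<pi>) \<noteq> (j \<in> {n div 2 + 1..n})}"

definition misplaced :: "nat \<Rightarrow> nat set set \<Rightarrow> nat" where
  "misplaced n \<pi> = card (misplaced_left n \<pi>) + card (misplaced_right n \<pi>)"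

text \<open>Central arcs \<open>(i, j)\<close> and \<open>(k, l)\<close> with \<open>i < k\<close>
  and \<open>j < l\<close> cross automatically, since \<open>k \<le> n div 2 < j\<close>.\<close>

definition central_arcs :: "nat \<Rightarrow> nat set set \<Rightarrow> (nat \<times> nat) set" where
  "central_arcs n \<pi> = {(i, j) \<in> arcs \<pi>. i \<le> n div 2 \<and> n div 2 < j}"

lemma finite_misplaced [simp]: "finite (misplaced_left n \<pi>)" "finite (misplaced_right n \<pi>)"
  by (simp_all add: misplaced_left_def misplaced_right_def)

text \<open>Among subsets of \<open>U\<close> the sum of \<open>g\<close> is largest on
  \<open>P\<close>. Omitting a point of \<open>P\<close> loses \<open>g x\<close>, including a point
  outside \<open>P\<close> loses \<open>- g x\<close>, and both are
  \<open>\<bar>g x\<bar>\<close>.\<close>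

lemma sum_plus_sum_abs_misplaced:
  fixes g :: "'a \<Rightarrow> 'b :: linordered_idom"
  assumes "finite U" "A \<subseteq> U" "P \<subseteq> U"
    and "\<And>x. x \<in> P \<Longrightarrow> 0 \<le> g x" "\<And>x. x \<in> U - P \<Longrightarrow> g x \<le> 0"
  shows "sum g A + (\<Sum>x | x \<in> U \<and> (x \<in> A) \<noteq> (x \<in> P). \<bar>g x\<bar>) = sum g P"
proof -
  have "sum g A = (\<Sum>x\<in>U. if x \<in> A then g x else 0)"
    using assms by (simp add: sum.inter_restrict[symmetric] Int_absorb1)
  moreover have "sum g P = (\<Sum>x\<in>U. if x \<in> P then g x else 0)"
    using assms by (simp add: sum.inter_restrict[symmetric] Int_absorb1)
  moreover have "(\<Sum>x | x \<in> U \<and> (x \<in> A) \<noteq> (x \<in> P). \<bar>g x\<bar>) =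
      (\<Sum>x\<in>U. if (x \<in> A) \<noteq> (x \<in> P) then \<bar>g x\<bar> else 0)"
    using assms(1) by (rule sum.inter_filter)
  moreover have "(\<Sum>x\<in>U. (if x \<in> A then g x else 0) + (if (x \<in> A) \<noteq> (x \<in> P) then \<bar>g x\<bar> else 0)) =
      (\<Sum>x\<in>U. if x \<in> P then g x else 0)"
    using assms(4,5) by (intro sum.cong) auto
  ultimately show ?thesis
    by (simp add: sum.distrib)
qed

lemma sum_const_minus_of_nat: "(\<Sum>i = 1..k. c - real i) = k * c - k * (k + 1) / 2"
  by (induction k) (simp_all add: field_simps)

lemma dimension_deficit:
  fixes n :: nat and c :: real
  defines "c \<equiv> real (n div 2) + 1 / 2"
  assumes \<pi>: "\<pi> \<in> set_partitions n"
  shows "real (dimension \<pi>) + (\<Sum>i\<in>misplaced_left n \<pi>. \<bar>c - i\<bar>) + (\<Sum>j\<in>misplaced_right n \<pi>. \<bar>j - c\<bar>)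
    \<le> (real n ^ 2 + 1) / 4"
proof -
  define m where "m = n div 2"
  have m: "m \<le> n" by (simp add: m_def)
  have c: "c = m + 1 / 2" by (simp add: c_def m_def)
  \<comment> \<open>Measured from the half-integer \<open>c\<close>, each length splits into
    contributions of its two ends. That of a left end is positive exactly up to \<open>m\<close>,
    that of a right end exactly beyond \<open>m\<close>.\<close>
  have "real (dimension \<pi>) = (\<Sum>(i, j)\<in>arcs \<pi>. (j - c) + (c - i))"
    unfolding dimension_def of_nat_sum
    by (rule sum.cong) (auto simp: arcs_def)
  also have "\<dots> = (\<Sum>a\<in>arcs \<pi>. snd a - c) + (\<Sum>a\<in>arcs \<pi>. c - fst a)"
    by (simp only: split_def sum.distrib)
  also have "(\<Sum>a\<in>arcs \<pi>. snd a - c) = (\<Sum>j\<in>snd ` arcs \<pi>. j - c)"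
    by (simp add: sum.reindex inj_on_snd_arcs[OF \<pi>])
  also have "(\<Sum>a\<in>arcs \<pi>. c - fst a) = (\<Sum>i\<in>fst ` arcs \<pi>. c - i)"
    by (simp add: sum.reindex inj_on_fst_arcs[OF \<pi>])
  finally have dim: "real (dimension \<pi>) = (\<Sum>j\<in>snd ` arcs \<pi>. j - c) + (\<Sum>i\<in>fst ` arcs \<pi>. c - i)" .
  have ends: "fst ` arcs \<pi> \<subseteq> {1..n}" "snd ` arcs \<pi> \<subseteq> {1..n}"
    using arcs_subset[OF \<pi>] by force+
  have L: "(\<Sum>i\<in>fst ` arcs \<pi>. c - i) + (\<Sum>i\<in>misplaced_left n \<pi>. \<bar>c - i\<bar>) = (\<Sum>i = 1..m. c - i)"
    unfolding misplaced_left_def m_def[symmetric] using ends m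
    by (intro sum_plus_sum_abs_misplaced[of "{1..n}"]) (auto simp: c)
  have R: "(\<Sum>j\<in>snd ` arcs \<pi>. j - c) + (\<Sum>j\<in>misplaced_right n \<pi>. \<bar>j - c\<bar>) = (\<Sum>j = m + 1..n. j - c)"
    unfolding misplaced_right_def m_def[symmetric] using ends m
    by (intro sum_plus_sum_abs_misplaced[of "{1..n}"]) (auto simp: c)
  \<comment> \<open>The sum over the upper half is read off from those over \<open>{1..n}\<close>
    and \<open>{1..m}\<close>, which have the closed form of
    \<open>sum_const_minus_of_nat\<close>.\<close>
  have "(\<Sum>i = 1..n. c - i) = (\<Sum>i = 1..m. c - i) + (\<Sum>i = m + 1..n. c - i)"
    using m by (subst sum.union_disjoint[symmetric]) (auto intro!: sum.cong)
  also have "(\<Sum>i = m + 1..n. c - i) = - (\<Sum>j = m + 1..n. j - c)"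
    by (simp add: sum_negf[symmetric])
  finally have "(\<Sum>i = 1..m. c - i) + (\<Sum>j = m + 1..n. j - c) =
      2 * (\<Sum>i = 1..m. c - i) - (\<Sum>i = 1..n. c - i)"
    by simp
  also have "\<dots> = (real m ^ 2 + (real n - real m) ^ 2) / 2"
    unfolding sum_const_minus_of_nat c by (simp add: field_simps power2_eq_square)
  \<comment> \<open>The left side is \<open>n ^ 2 / 4\<close> for even \<open>n\<close> and equals
    the bound for odd \<open>n\<close>.\<close>
  also have "\<dots> \<le> (real n ^ 2 + 1) / 4"
  proof -
    have "n = 2 * m \<or> n = 2 * m + 1" unfolding m_def by linarith
    then show ?thesis by (auto simp: field_simps power2_eq_square)
  qed
  finally show ?thesis using L R dim by linarith
qed

text \<open>Markov's inequality, as at most \<open>2 k\<close> integers are closer than \<open>k\<close> to \<open>m + 1/2\<close>.\<close>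

lemma card_le_sum_dist:
  fixes S :: "nat set" and m k :: nat
  assumes "finite S"
  shows "k * real (card S) \<le> 2 * k ^ 2 + (\<Sum>i\<in>S. \<bar>real i - (m + 1 / 2)\<bar>)"
proof -
  \<comment> \<open>Points outside \<open>I\<close> are farther than \<open>k\<close> from
    \<open>m + 1 / 2\<close>. If \<open>k > m + 1\<close>, the lower end is truncated to 0 and
    \<open>I\<close> has \<open>m + k + 1 \<le> 2 * k\<close> elements.\<close>
  define I where "I = {m + 1 - k..m + k}"
  have "card (S \<inter> I) \<le> card I"
    by (intro card_mono) (auto simp: I_def)
  also have "\<dots> \<le> 2 * k" by (simp add: I_def)
  finally have "real (card (S \<inter> I)) \<le> 2 * k" by (simp flip: of_nat_le_iff)
  then have 1: "k * real (card (S \<inter> I)) \<le> 2 * k ^ 2"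
    using mult_left_mono[of "real (card (S \<inter> I))" "2 * k" "real k"] by (simp add: power2_eq_square)
  have "k * real (card (S - I)) = (\<Sum>i\<in>S - I. real k)" by simp
  also have "\<dots> \<le> (\<Sum>i\<in>S - I. \<bar>real i - (m + 1 / 2)\<bar>)"
    by (intro sum_mono) (auto simp: I_def)
  also have "\<dots> \<le> (\<Sum>i\<in>S. \<bar>real i - (m + 1 / 2)\<bar>)"
    using assms by (intro sum_mono2) auto
  finally have 2: "k * real (card (S - I)) \<le> \<dots>" .
  have "card S = card (S \<inter> I) + card (S - I)"
    using assms by (subst card_Un_disjoint[symmetric]) (auto intro: arg_cong[of _ _ card])
  then show ?thesis using 1 2 by (simp add: algebra_simps)
qed

text \<open>The parameter \<open>k\<close> stays free: its choice later balances the two terms on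
  the right, and \<open>k = 0\<close> gives the upper bound \<open>(n ^ 2 + 1) / 4\<close> on the
  dimension.\<close>

lemma misplaced_le_deficit:
  fixes k :: nat
  assumes "\<pi> \<in> set_partitions n"
  shows "k * real (misplaced n \<pi>) \<le> 4 * k ^ 2 + ((real n ^ 2 + 1) / 4 - dimension \<pi>)"
proof -
  have "k * real (card (misplaced_left n \<pi>)) \<le>
      2 * k ^ 2 + (\<Sum>i\<in>misplaced_left n \<pi>. \<bar>real i - (real (n div 2) + 1 / 2)\<bar>)"
    by (rule card_le_sum_dist) simp
  moreover have "k * real (card (misplaced_right n \<pi>)) \<le>
      2 * k ^ 2 + (\<Sum>i\<in>misplaced_right n \<pi>. \<bar>real i - (real (n div 2) + 1 / 2)\<bar>)"
    by (rule card_le_sum_dist) simp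
  moreover note dimension_deficit[OF assms]
  ultimately show ?thesis
    by (simp add: misplaced_def field_simps abs_minus_commute)
qed

section \<open>Central arcs and their distance to the antidiagonal\<close>

lemma central_arcs_subset: "central_arcs n \<pi> \<subseteq> arcs \<pi>"
  by (auto simp: central_arcs_def)

lemma finite_central_arcs: "\<pi> \<in> set_partitions n \<Longrightarrow> finite (central_arcs n \<pi>)"
  using finite_arcs central_arcs_subset finite_subset by metis

lemma card_arcs_le: assumes "\<pi> \<in> set_partitions n" shows "card (arcs \<pi>) \<le> n"
proof -
  have "card (arcs \<pi>) = card (fst ` arcs \<pi>)"
    using inj_on_fst_arcs[OF assms] by (simp add: card_image)
  also have "\<dots> \<le> card {1..n}"
    using arcs_subset[OF assms] by (intro card_mono) force+
  finally show ?thesis by simp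
qed

text \<open>An arc that is not central starts in the upper half or ends in the lower half, so it has
  a misplaced end. Distinct arcs have distinct left ends and distinct right ends.\<close>

lemma card_noncentral_arcs:
  assumes \<pi>: "\<pi> \<in> set_partitions n"
  shows "card (arcs \<pi> - central_arcs n \<pi>) \<le> misplaced n \<pi>"
proof -
  define A where "A = {a \<in> arcs \<pi>. n div 2 < fst a}"
  define B where "B = {a \<in> arcs \<pi>. snd a \<le> n div 2}"
  have fin: "finite A" "finite B" using finite_arcs[OF \<pi>] by (auto simp: A_def B_def)
  have "card (arcs \<pi> - central_arcs n \<pi>) \<le> card (A \<union> B)"
    using fin by (intro card_mono) (auto simp: A_def B_def central_arcs_def)
  also have "\<dots> \<le> card A + card B" by (rule card_Un_le)
  also have "card A = card (fst ` A)"
    by (rule card_image[symmetric], rule inj_on_subset[OF inj_on_fst_arcs[OF \<pi>]]) (auto simp: A_def)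
  also have "\<dots> \<le> card (misplaced_left n \<pi>)"
    using arcs_subset[OF \<pi>] by (intro card_mono) (force simp: A_def misplaced_left_def)+
  also have "card B = card (snd ` B)"
    by (rule card_image[symmetric], rule inj_on_subset[OF inj_on_snd_arcs[OF \<pi>]]) (auto simp: B_def)
  also have "\<dots> \<le> card (misplaced_right n \<pi>)"
    using arcs_subset[OF \<pi>] by (intro card_mono) (force simp: B_def misplaced_right_def)+
  finally show ?thesis by (simp add: misplaced_def)
qed

text \<open>A point of the lower half that starts no central arc is either no left end, hence
  misplaced, or starts an arc that ends in the lower half. The latter are counted by their misplaced
  right ends.\<close>

lemma card_uncovered_left:
  assumes \<pi>: "\<pi> \<in> set_partitions n"
  shows "card ({1..n div 2} - fst ` central_arcs n \<pi>) \<le> misplaced n \<pi>"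
proof -
  define B where "B = {a \<in> arcs \<pi>. snd a \<le> n div 2}"
  have fin: "finite B" using finite_arcs[OF \<pi>] by (auto simp: B_def)
  have "{1..n div 2} - fst ` central_arcs n \<pi> \<subseteq> misplaced_left n \<pi> \<union> fst ` B"
  proof
    fix i assume i: "i \<in> {1..n div 2} - fst ` central_arcs n \<pi>"
    show "i \<in> misplaced_left n \<pi> \<union> fst ` B"
    proof (cases "i \<in> fst ` arcs \<pi>")
      case True
      then obtain j where "(i, j) \<in> arcs \<pi>" by auto
      then have "(i, j) \<in> B" using i by (force simp: B_def central_arcs_def)
      then show ?thesis by force
    next
      case False
      then show ?thesis using i by (auto simp: misplaced_left_def)
    qed
  qed
  then have "card ({1..n div 2} - fst ` central_arcs n \<pi>) \<le> card (misplaced_left n \<pi> \<union> fst ` B)"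
    using fin by (intro card_mono) auto
  also have "\<dots> \<le> card (misplaced_left n \<pi>) + card (fst ` B)" by (rule card_Un_le)
  also have "card (fst ` B) \<le> card B" using fin by (rule card_image_le)
  also have "card B = card (snd ` B)"
    by (rule card_image[symmetric], rule inj_on_subset[OF inj_on_snd_arcs[OF \<pi>]]) (auto simp: B_def)
  also have "\<dots> \<le> card (misplaced_right n \<pi>)"
    using arcs_subset[OF \<pi>] by (intro card_mono) (force simp: B_def misplaced_right_def)+
  finally show ?thesis by (simp add: misplaced_def)
qed

text \<open>Mirror image of \<open>card_uncovered_left\<close>.\<close>

lemma card_uncovered_right:
  assumes \<pi>: "\<pi> \<in> set_partitions n"
  shows "card ({n div 2 + 1..n} - snd ` central_arcs n \<pi>) \<le> misplaced n \<pi>"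
proof -
  define A where "A = {a \<in> arcs \<pi>. n div 2 < fst a}"
  have fin: "finite A" using finite_arcs[OF \<pi>] by (auto simp: A_def)
  have "{n div 2 + 1..n} - snd ` central_arcs n \<pi> \<subseteq> misplaced_right n \<pi> \<union> snd ` A"
  proof
    fix j assume j: "j \<in> {n div 2 + 1..n} - snd ` central_arcs n \<pi>"
    show "j \<in> misplaced_right n \<pi> \<union> snd ` A"
    proof (cases "j \<in> snd ` arcs \<pi>")
      case True
      then obtain i where "(i, j) \<in> arcs \<pi>" by auto
      then have "(i, j) \<in> A" using j by (force simp: A_def central_arcs_def)
      then show ?thesis by force
    next
      case False
      then show ?thesis using j by (auto simp: misplaced_right_def)
    qed
  qed
  then have "card ({n div 2 + 1..n} - snd ` central_arcs n \<pi>) \<le> card (misplaced_right n \<pi> \<union> snd ` A)"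
    using fin by (intro card_mono) auto
  also have "\<dots> \<le> card (misplaced_right n \<pi>) + card (snd ` A)" by (rule card_Un_le)
  also have "card (snd ` A) \<le> card A" using fin by (rule card_image_le)
  also have "card A = card (fst ` A)"
    by (rule card_image[symmetric], rule inj_on_subset[OF inj_on_fst_arcs[OF \<pi>]]) (auto simp: A_def)
  also have "\<dots> \<le> card (misplaced_left n \<pi>)"
    using arcs_subset[OF \<pi>] by (intro card_mono) (force simp: A_def misplaced_left_def)+
  finally show ?thesis by (simp add: misplaced_def)
qed

text \<open>Left of \<open>i\<close> almost every point starts a central arc. Such an arc either crosses \<open>(i, j)\<close> or
  encloses it, and it can enclose \<open>(i, j)\<close> in at most \<open>n - j\<close> ways. The second bound is the mirror image.\<close>

lemma central_arc_antidiagonal_upper: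
  assumes \<pi>: "\<pi> \<in> set_partitions n" and ij: "(i, j) \<in> central_arcs n \<pi>"
  shows "real i + real j - real n - 1 \<le>
    misplaced n \<pi> + card {a \<in> central_arcs n \<pi>. fst a < i \<and> snd a < j}"
proof -
  let ?G = "central_arcs n \<pi>"
  note fin = finite_central_arcs[OF \<pi>]
  have j: "i \<le> n div 2" "1 \<le> i" "j \<le> n" "(i, j) \<in> arcs \<pi>"
    using ij arcs_subset[OF \<pi>] by (auto simp: central_arcs_def)
  define C where "C = {a \<in> ?G. fst a < i \<and> snd a < j}"
  define E where "E = {a \<in> ?G. fst a < i \<and> j < snd a}"
  have "{1..<i} \<subseteq> ({1..n div 2} - fst ` ?G) \<union> fst ` (C \<union> E)"
  proof
    fix k assume k: "k \<in> {1..<i}"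
    show "k \<in> ({1..n div 2} - fst ` ?G) \<union> fst ` (C \<union> E)"
    proof (cases "k \<in> fst ` ?G")
      case True
      then obtain l where l: "(k, l) \<in> ?G" by auto
      have "l \<noteq> j"
        using l k j inj_onD[OF inj_on_snd_arcs[OF \<pi>], of "(k, l)" "(i, j)"]
        by (auto simp: central_arcs_def)
      then have "(k, l) \<in> C \<union> E" using l k by (auto simp: C_def E_def)
      then show ?thesis by force
    qed (use k j in auto)
  qed
  then have "card {1..<i} \<le> card (({1..n div 2} - fst ` ?G) \<union> fst ` (C \<union> E))"
    using fin by (intro card_mono) (auto simp: C_def E_def)
  also have "\<dots> \<le> card ({1..n div 2} - fst ` ?G) + card (fst ` (C \<union> E))" by (rule card_Un_le)
  also have "card (fst ` (C \<union> E)) \<le> card (C \<union> E)"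
    using fin by (intro card_image_le) (auto simp: C_def E_def)
  also have "card (C \<union> E) \<le> card C + card E" by (rule card_Un_le)
  also have "card E = card (snd ` E)"
    by (rule card_image[symmetric], rule inj_on_subset[OF inj_on_snd_arcs[OF \<pi>]])
      (auto simp: E_def central_arcs_def)
  also have "\<dots> \<le> card {j<..n}"
    using arcs_subset[OF \<pi>] by (intro card_mono) (auto simp: E_def central_arcs_def)
  also note card_uncovered_left[OF \<pi>]
  finally have "i - 1 \<le> misplaced n \<pi> + (card C + (n - j))" by simp
  then show ?thesis using j unfolding C_def by linarith
qed

lemma central_arc_antidiagonal_lower:
  assumes \<pi>: "\<pi> \<in> set_partitions n" and ij: "(i, j) \<in> central_arcs n \<pi>"
  shows "real n + 1 - real i - real j \<le>
    misplaced n \<pi> + card {a \<in> central_arcs n \<pi>. i < fst a \<and> j < snd a}"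
proof -
  let ?G = "central_arcs n \<pi>"
  note fin = finite_central_arcs[OF \<pi>]
  have j: "n div 2 < j" "1 \<le> i" "j \<le> n" "(i, j) \<in> arcs \<pi>"
    using ij arcs_subset[OF \<pi>] by (auto simp: central_arcs_def)
  define C where "C = {a \<in> ?G. i < fst a \<and> j < snd a}"
  \<comment> \<open>Reflection takes enclosing arcs to enclosing arcs; here they are counted by
    their left ends in \<open>{1..<i}\<close> instead of their right ends.\<close>
  define E where "E = {a \<in> ?G. fst a < i \<and> j < snd a}"
  have "{j<..n} \<subseteq> ({n div 2 + 1..n} - snd ` ?G) \<union> snd ` (C \<union> E)"
  proof
    fix l assume l: "l \<in> {j<..n}"
    show "l \<in> ({n div 2 + 1..n} - snd ` ?G) \<union> snd ` (C \<union> E)"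
    proof (cases "l \<in> snd ` ?G")
      case True
      then obtain k where k: "(k, l) \<in> ?G" by auto
      have "k \<noteq> i"
        using k l j inj_onD[OF inj_on_fst_arcs[OF \<pi>], of "(k, l)" "(i, j)"]
        by (auto simp: central_arcs_def)
      then have "(k, l) \<in> C \<union> E" using l k by (auto simp: C_def E_def)
      then show ?thesis by force
    qed (use l j in auto)
  qed
  then have "card {j<..n} \<le> card (({n div 2 + 1..n} - snd ` ?G) \<union> snd ` (C \<union> E))"
    using fin by (intro card_mono) (auto simp: C_def E_def)
  also have "\<dots> \<le> card ({n div 2 + 1..n} - snd ` ?G) + card (snd ` (C \<union> E))" by (rule card_Un_le)
  also have "card (snd ` (C \<union> E)) \<le> card (C \<union> E)"
    using fin by (intro card_image_le) (auto simp: C_def E_def)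
  also have "card (C \<union> E) \<le> card C + card E" by (rule card_Un_le)
  also have "card E = card (fst ` E)"
    by (rule card_image[symmetric], rule inj_on_subset[OF inj_on_fst_arcs[OF \<pi>]])
      (auto simp: E_def central_arcs_def)
  also have "\<dots> \<le> card {1..<i}"
    using arcs_subset[OF \<pi>] by (intro card_mono) (auto simp: E_def central_arcs_def)
  also note card_uncovered_right[OF \<pi>]
  finally have "n - j \<le> misplaced n \<pi> + (card C + (i - 1))" by simp
  then show ?thesis using j unfolding C_def by linarith
qed

section \<open>Crossings and the total distance to the antidiagonal\<close>

lemma finite_crossings:
  assumes "\<pi> \<in> set_partitions n"
  shows "finite (crossings \<pi>)"
  by (rule finite_subset[of _ "Pow (arcs \<pi>)"]) (use finite_arcs[OF assms] in \<open>auto simp: crossings_def\<close>)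

text \<open>The order of the left ends recovers the ordered pair from the unordered one, and
  centrality supplies the middle inequality \<open>k < j\<close> of a crossing.\<close>

lemma card_central_crossings_le_crs:
  assumes \<pi>: "\<pi> \<in> set_partitions n"
  shows "card {(a, b) \<in> central_arcs n \<pi> \<times> central_arcs n \<pi>. fst a < fst b \<and> snd a < snd b} \<le> crs \<pi>"
    (is "card ?C \<le> _")
  unfolding crs_def
proof (rule card_inj_on_le[where f = "\<lambda>(a, b). {a, b}"])
  show "inj_on (\<lambda>(a, b). {a, b}) ?C"
    by (rule inj_onI) (auto simp: doubleton_eq_iff)
  show "(\<lambda>(a, b). {a, b}) ` ?C \<subseteq> crossings \<pi>"
    by (fastforce simp: crossings_def central_arcs_def)
qed (rule finite_crossings[OF \<pi>])

text \<open>Summing the two one-sided bounds over the at most \<open>n\<close> central arcs, each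
  crossing of central arcs is counted twice, once at each of its arcs.\<close>

lemma sum_antidiagonal_distance:
  assumes \<pi>: "\<pi> \<in> set_partitions n"
  shows "(\<Sum>(i, j)\<in>central_arcs n \<pi>. \<bar>real n + 1 - i - j\<bar>) \<le> n * misplaced n \<pi> + 2 * crs \<pi>"
proof -
  let ?G = "central_arcs n \<pi>" and ?w = "real (misplaced n \<pi>)"
  let ?R = "\<lambda>a b :: nat \<times> nat. fst a < fst b \<and> snd a < snd b"
  let ?C = "{(a, b) \<in> ?G \<times> ?G. ?R a b}"
  note fin = finite_central_arcs[OF \<pi>]
  have "(\<Sum>(i, j)\<in>?G. \<bar>real n + 1 - i - j\<bar>) \<le>
      (\<Sum>b\<in>?G. ?w + real (card {a \<in> ?G. ?R a b}) + real (card {a \<in> ?G. ?R b a}))"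
  proof (rule sum_mono)
    fix b assume "b \<in> ?G"
    then show "(case b of (i, j) \<Rightarrow> \<bar>real n + 1 - i - j\<bar>) \<le>
        ?w + real (card {a \<in> ?G. ?R a b}) + real (card {a \<in> ?G. ?R b a})"
      using central_arc_antidiagonal_upper[OF \<pi>, of "fst b" "snd b"]
        central_arc_antidiagonal_lower[OF \<pi>, of "fst b" "snd b"]
      by (auto simp: case_prod_beta abs_le_iff)
  qed
  also have "\<dots> = card ?G * ?w + real (\<Sum>b\<in>?G. card {a \<in> ?G. ?R a b}) + real (\<Sum>b\<in>?G. card {a \<in> ?G. ?R b a})"
    by (simp add: sum.distrib)
  also have "(\<Sum>b\<in>?G. card {a \<in> ?G. ?R b a}) = card ?C"
  proof -
    have "?C = (SIGMA b:?G. {a \<in> ?G. ?R b a})" by auto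
    then show ?thesis using fin by simp
  qed
  also have "(\<Sum>b\<in>?G. card {a \<in> ?G. ?R a b}) = card ?C"
  proof -
    have "?C = prod.swap ` (SIGMA b:?G. {a \<in> ?G. ?R a b})" by auto
    then show ?thesis using fin by (simp add: card_image)
  qed
  also have "card ?G * ?w \<le> n * ?w"
    using card_mono[OF finite_arcs[OF \<pi>] central_arcs_subset[of n]] card_arcs_le[OF \<pi>]
    by (intro mult_right_mono) auto
  finally show ?thesis
    using card_central_crossings_le_crs[OF \<pi>] by simp
qed

section \<open>Integrals of the measures on the triangle\<close>

lemma compact_cell: "compact (cell n i j)"
  unfolding cell_def by (intro compact_Times) auto

lemma cell_borel [measurable]: "cell n i j \<in> sets borel"
  using compact_cell compact_imp_closed borel_closed by blast

lemma emeasure_cell: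
  assumes "n \<ge> 1"
  shows "emeasure lborel (cell n i j) = ennreal (1 / real n ^ 2)"
proof -
  have side: "emeasure lborel {(real k - 1) / n .. real k / n} = ennreal (1 / n)" for k
    using assms by (subst emeasure_lborel_Icc) (auto simp: divide_simps)
  have "emeasure lborel (cell n i j) = emeasure (lborel \<Otimes>\<^sub>M lborel) (cell n i j)"
    by (simp add: lborel_prod)
  also have "\<dots> = ennreal (1 / n) * ennreal (1 / n)"
    unfolding cell_def by (subst lborel.emeasure_pair_measure_Times) (simp_all add: side)
  finally show ?thesis
    by (simp add: power2_eq_square flip: ennreal_mult)
qed

text \<open>The factor \<open>n\<close> is the mass \<open>1 / n\<close> of an arc divided by the
  area \<open>1 / n ^ 2\<close> of its cell. In this form integrals against the measure become
  finite sums of Lebesgue integrals over cells.\<close>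

lemma partition_measure_eq_density:
  assumes \<pi>: "\<pi> \<in> set_partitions n" and n: "n \<ge> 1"
  shows "partition_measure n \<pi> = density (restrict_space lborel upper_triangle)
    (\<lambda>z. ennreal (\<Sum>(i, j)\<in>arcs \<pi>. real n * indicator (cell n i j) z))"
    (is "_ = density ?L (\<lambda>z. ennreal (?h z))")
proof (rule measure_eqI)
  have sets: "sets ?L = sets (restrict_space borel upper_triangle)"
    by (intro sets_restrict_space_cong) simp
  then show "sets (partition_measure n \<pi>) = sets (density ?L (\<lambda>z. ennreal (?h z)))"
    by simp
  fix S assume "S \<in> sets (partition_measure n \<pi>)"
  then have S: "S \<in> sets (restrict_space borel upper_triangle)" "S \<subseteq> upper_triangle" "S \<in> sets borel"
    by (auto simp: sets_restrict_space)
  have h: "?h \<in> borel_measurable borel"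
    by (intro borel_measurable_sum) (auto simp: case_prod_beta)
  have "emeasure (density ?L (\<lambda>z. ennreal (?h z))) S = (\<integral>\<^sup>+ z. ennreal (?h z) * indicator S z \<partial>?L)"
  proof (rule emeasure_density)
    show "(\<lambda>z. ennreal (?h z)) \<in> borel_measurable ?L"
      using h by (intro measurable_restrict_space1 measurable_compose[OF _ measurable_ennreal]) simp
    show "S \<in> sets ?L" using S sets by simp
  qed
  also have "\<dots> = (\<integral>\<^sup>+ z. ennreal (?h z) * indicator S z * indicator upper_triangle z \<partial>lborel)"
    by (rule nn_integral_restrict_space) simp
  also have "\<dots> = (\<integral>\<^sup>+ z. (\<Sum>a\<in>arcs \<pi>. ennreal n * indicator (cell n (fst a) (snd a) \<inter> S) z) \<partial>lborel)"
  proof (rule nn_integral_cong)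
    fix z
    have "ennreal (?h z) = (\<Sum>a\<in>arcs \<pi>. ennreal n * indicator (cell n (fst a) (snd a)) z)"
      by (subst sum_ennreal[symmetric])
        (auto simp: case_prod_beta ennreal_mult ennreal_indicator intro!: sum.cong)
    then show "ennreal (?h z) * indicator S z * indicator upper_triangle z =
        (\<Sum>a\<in>arcs \<pi>. ennreal n * indicator (cell n (fst a) (snd a) \<inter> S) z)"
      using S(2) by (cases "z \<in> S") (auto simp: indicator_def)
  qed
  also have "\<dots> = (\<Sum>a\<in>arcs \<pi>. ennreal n * emeasure lborel (cell n (fst a) (snd a) \<inter> S))"
    using S(3) by (subst nn_integral_sum) (auto intro!: sum.cong simp: nn_integral_cmult)
  also have "\<dots> = (\<Sum>a\<in>arcs \<pi>. ennreal (1 / n) *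
      emeasure (uniform_measure lborel (cell n (fst a) (snd a))) S)"
  proof (rule sum.cong)
    fix a
    have "emeasure (uniform_measure lborel (cell n (fst a) (snd a))) S =
        emeasure lborel (cell n (fst a) (snd a) \<inter> S) / ennreal (1 / real n ^ 2)"
      using S(3) n by (subst emeasure_uniform_measure) (simp_all add: emeasure_cell)
    also have "\<dots> = emeasure lborel (cell n (fst a) (snd a) \<inter> S) * ennreal (real n ^ 2)"
      using n by (simp add: divide_ennreal_def inverse_ennreal)
    finally have "ennreal (1 / n) * emeasure (uniform_measure lborel (cell n (fst a) (snd a))) S =
        (ennreal (1 / n) * ennreal (real n ^ 2)) * emeasure lborel (cell n (fst a) (snd a) \<inter> S)"
      by (simp add: mult_ac)
    also have "ennreal (1 / n) * ennreal (real n ^ 2) = ennreal n"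
      using n by (simp add: power2_eq_square flip: ennreal_mult)
    finally show "ennreal n * emeasure lborel (cell n (fst a) (snd a) \<inter> S) =
        ennreal (1 / n) * emeasure (uniform_measure lborel (cell n (fst a) (snd a))) S" by simp
  qed simp
  also have "\<dots> = emeasure (partition_measure n \<pi>) S"
    using emeasure_partition_measure[OF S(1), of n \<pi>]
    by (simp add: case_prod_beta sum_distrib_left)
  finally show "emeasure (partition_measure n \<pi>) S = emeasure (density ?L (\<lambda>z. ennreal (?h z))) S" ..
qed

lemma borel_measurable_upper_triangle:
  fixes f :: "real \<times> real \<Rightarrow> real"
  assumes "continuous_on upper_triangle f"
  shows "f \<in> borel_measurable (restrict_space lborel upper_triangle)"
    and "f \<in> borel_measurable (restrict_space borel upper_triangle)"
proof -
  show *: "f \<in> borel_measurable (restrict_space borel upper_triangle)"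
    using assms by (rule borel_measurable_continuous_on_restrict)
  have "sets (restrict_space lborel upper_triangle) = sets (restrict_space borel upper_triangle)"
    by (intro sets_restrict_space_cong) simp
  then show "f \<in> borel_measurable (restrict_space lborel upper_triangle)"
    using * by (simp cong: measurable_cong_sets)
qed

lemma integral_partition_measure:
  fixes f :: "real \<times> real \<Rightarrow> real"
  assumes \<pi>: "\<pi> \<in> set_partitions n" and n: "n \<ge> 1" and f: "continuous_on upper_triangle f"
  shows "(\<integral>z. f z \<partial>partition_measure n \<pi>) = (\<Sum>(i, j)\<in>arcs \<pi>. n * (LINT z:cell n i j|lborel. f z))"
proof -
  let ?L = "restrict_space lborel upper_triangle"
  let ?h = "\<lambda>z. \<Sum>(i, j)\<in>arcs \<pi>. real n * indicator (cell n i j) z :: real"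
  have sub: "cell n (fst a) (snd a) \<subseteq> upper_triangle" if "a \<in> arcs \<pi>" for a
    using arcs_subset[OF \<pi>, of "fst a" "snd a"] that by (intro cell_subset_upper_triangle) auto
  have h: "?h \<in> borel_measurable borel"
    by (intro borel_measurable_sum) (auto simp: case_prod_beta)
  have int: "integrable lborel (\<lambda>z. indicator (cell n (fst a) (snd a)) z *\<^sub>R f z)" if "a \<in> arcs \<pi>" for a
    by (rule borel_integrable_compact[OF compact_cell continuous_on_subset[OF f sub[OF that]]])
  have "(\<integral>z. f z \<partial>partition_measure n \<pi>) = (\<integral>z. ?h z *\<^sub>R f z \<partial>?L)"
    unfolding partition_measure_eq_density[OF \<pi> n]
  proof (rule integral_density)
    show "?h \<in> borel_measurable ?L"
      using h by (intro measurable_restrict_space1) simp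
  qed (auto intro!: borel_measurable_upper_triangle f sum_nonneg AE_I2)
  also have "\<dots> = (\<integral>z. indicator upper_triangle z *\<^sub>R (?h z *\<^sub>R f z) \<partial>lborel)"
    by (rule integral_restrict_space) simp
  also have "\<dots> = (\<integral>z. (\<Sum>a\<in>arcs \<pi>. real n * (indicator (cell n (fst a) (snd a)) z *\<^sub>R f z)) \<partial>lborel)"
  proof (rule Bochner_Integration.integral_cong)
    fix z
    show "indicator upper_triangle z *\<^sub>R (?h z *\<^sub>R f z) =
        (\<Sum>a\<in>arcs \<pi>. real n * (indicator (cell n (fst a) (snd a)) z *\<^sub>R f z))"
    proof (cases "z \<in> upper_triangle")
      case True
      then show ?thesis by (simp add: case_prod_beta sum_distrib_left mult_ac)
    next
      case False
      then have "z \<notin> cell n (fst a) (snd a)" if "a \<in> arcs \<pi>" for a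
        using sub[OF that] by blast
      then show ?thesis using False by simp
    qed
  qed simp
  also have "\<dots> = (\<Sum>a\<in>arcs \<pi>. n * (\<integral>z. indicator (cell n (fst a) (snd a)) z *\<^sub>R f z \<partial>lborel))"
    by (simp only: Bochner_Integration.integral_sum[OF integrable_mult_right[OF int]]
        integral_mult_right_zero)
  finally show ?thesis
    by (simp add: case_prod_beta set_lebesgue_integral_def)
qed

text \<open>An integral over an interval is the form needed to cut it into strips of width
  \<open>1 / n\<close>, one for each possible left end.\<close>

lemma integral_Omega:
  fixes f :: "real \<times> real \<Rightarrow> real"
  assumes f: "continuous_on upper_triangle f"
  shows "(\<integral>z. f z \<partial>Omega) = integral {0..1 / 2} (\<lambda>x. f (x, 1 - x))"
proof -
  have "(\<integral>z. f z \<partial>Omega) = (\<integral>x. f (x, 1 - x) \<partial>restrict_space lborel {0..1 / 2})"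
    unfolding Omega_def
    by (rule integral_distr[OF antidiagonal_measurable borel_measurable_upper_triangle(2)[OF f]])
  also have "\<dots> = (LINT x:{0..1 / 2}|lborel. f (x, 1 - x))"
    unfolding set_lebesgue_integral_def by (rule integral_restrict_space) simp
  also have "\<dots> = integral {0..1 / 2} (\<lambda>x. f (x, 1 - x))"
  proof (rule set_borel_integral_eq_integral(2), unfold set_integrable_def, rule borel_integrable_compact)
    show "continuous_on {0..1 / 2} (\<lambda>x. f (x, 1 - x))"
      by (rule continuous_on_compose2[OF f]) (auto intro!: continuous_intros simp: upper_triangle_def)
  qed simp
  finally show ?thesis .
qed

section \<open>Comparison of the two integrals\<close>

text \<open>The constant \<open>c\<close> itself contributes exactly \<open>c / n\<close>. Used with
  \<open>c\<close> a value of \<open>f\<close> on the antidiagonal, and with \<open>c = 0\<close>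
  and \<open>e\<close> a bound of \<open>f\<close>.\<close>

lemma set_integral_cell_near_const:
  fixes f :: "real \<times> real \<Rightarrow> real"
  assumes f: "continuous_on (cell n i j) f" and n: "n \<ge> 1"
    and le: "\<And>z. z \<in> cell n i j \<Longrightarrow> \<bar>f z - c\<bar> \<le> e"
  shows "\<bar>n * (LINT z:cell n i j|lborel. f z) - c / n\<bar> \<le> e / n"
proof -
  let ?A = "cell n i j"
  have m: "measure lborel ?A = 1 / real n ^ 2"
    using emeasure_cell[OF n, of i j] by (simp add: measure_def)
  have int_const: "integrable lborel (\<lambda>z. indicator ?A z *\<^sub>R b)" for b :: real
    by (rule borel_integrable_compact[OF compact_cell]) simp
  have int: "integrable lborel (\<lambda>z. indicator ?A z *\<^sub>R f z)"
    by (rule borel_integrable_compact[OF compact_cell f])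
  have "(LINT z:?A|lborel. f z) - c / real n ^ 2 =
      (\<integral>z. indicator ?A z *\<^sub>R f z - indicator ?A z *\<^sub>R c \<partial>lborel)"
    using m unfolding set_lebesgue_integral_def Bochner_Integration.integral_diff[OF int int_const] by simp
  also have "\<bar>\<dots>\<bar> \<le> (\<integral>z. indicator ?A z *\<^sub>R e \<partial>lborel)"
    using le int int_const
    by (intro order_trans[OF integral_abs_bound] integral_mono)
      (auto intro!: integrable_abs Bochner_Integration.integrable_diff simp: indicator_def)
  also have "\<dots> = e / real n ^ 2" using m by simp
  finally have *: "\<bar>(LINT z:?A|lborel. f z) - c / real n ^ 2\<bar> \<le> e / real n ^ 2" .
  have "n * (LINT z:?A|lborel. f z) - c / n = n * ((LINT z:?A|lborel. f z) - c / real n ^ 2)"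
    using n by (simp add: field_simps power2_eq_square)
  then have "\<bar>n * (LINT z:?A|lborel. f z) - c / n\<bar> = n * \<bar>(LINT z:?A|lborel. f z) - c / real n ^ 2\<bar>"
    by (simp add: abs_mult)
  also have "\<dots> \<le> n * (e / real n ^ 2)" using * by (intro mult_left_mono) auto
  finally show ?thesis using n by (simp add: power2_eq_square)
qed

lemma integral_interval_near_const:
  fixes g :: "real \<Rightarrow> real"
  assumes "a \<le> b" "continuous_on {a..b} g" "\<And>x. x \<in> {a..b} \<Longrightarrow> \<bar>g x - c\<bar> \<le> e"
  shows "\<bar>integral {a..b} g - (b - a) * c\<bar> \<le> (b - a) * e"
proof -
  have "norm (integral {a..b} (\<lambda>x. g x - c)) \<le> e * (b - a)"
    using assms by (intro integral_bound) (auto intro!: continuous_intros)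
  moreover have "integral {a..b} (\<lambda>x. g x - c) = integral {a..b} g - (b - a) * c"
    using assms by (subst integral_diff) (auto intro: integrable_continuous_real)
  ultimately show ?thesis by (simp add: mult_ac)
qed

lemma integral_equidistant_split:
  fixes g :: "real \<Rightarrow> real"
  assumes "continuous_on {0..m / n} g" "n > 0"
  shows "(\<Sum>i = 1..m. integral {(real i - 1) / n .. real i / n} g) = integral {0 .. real m / real n} g"
  using assms(1)
proof (induction m)
  case (Suc m)
  have le: "real m / n \<le> real (Suc m) / n" by (simp add: divide_right_mono)
  have "integral {0 .. real m / n} g + integral {real m / n .. real (Suc m) / n} g =
      integral {0 .. real (Suc m) / n} g"
    using le Suc.prems by (intro Henstock_Kurzweil_Integration.integral_combine integrable_continuous_real) auto
  moreover have "continuous_on {0..real m / n} g"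
    using le by (intro continuous_on_subset[OF Suc.prems]) auto
  ultimately show ?case using Suc.IH by simp
qed simp

text \<open>Points closer than the \<open>d\<close> of uniform continuity are covered by
  \<open>\<epsilon>\<close>; for the others the trivial bound \<open>2 * B\<close> is at most
  \<open>2 * B / d\<close> times the distance. A modulus affine in the distance can be summed over
  arcs, so that control of the average distance suffices.\<close>

lemma uniform_continuity_affine_bound:
  fixes f :: "'a :: metric_space \<Rightarrow> real"
  assumes "compact S" "continuous_on S f" "\<epsilon> > 0"
  obtains K where "K \<ge> 0" "\<And>z w. z \<in> S \<Longrightarrow> w \<in> S \<Longrightarrow> \<bar>f z - f w\<bar> \<le> \<epsilon> + K * dist z w"
proof -
  obtain B where B: "B > 0" "\<And>z. z \<in> S \<Longrightarrow> \<bar>f z\<bar> \<le> B"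
    using compact_imp_bounded[OF compact_continuous_image[OF assms(2,1)]] by (auto simp: bounded_pos)
  obtain d where d: "d > 0" "\<And>z w. z \<in> S \<Longrightarrow> w \<in> S \<Longrightarrow> dist z w < d \<Longrightarrow> \<bar>f z - f w\<bar> < \<epsilon>"
    using compact_uniformly_continuous[OF assms(2,1)] assms(3)
    unfolding uniformly_continuous_on_def dist_real_def by meson
  show ?thesis
  proof (rule that[of "2 * B / d"])
    fix z w assume zw: "z \<in> S" "w \<in> S"
    show "\<bar>f z - f w\<bar> \<le> \<epsilon> + 2 * B / d * dist z w"
    proof (cases "dist z w < d")
      case True
      then show ?thesis using d(2)[OF zw] B(1) d(1) by (smt (verit) zero_le_dist divide_nonneg_pos mult_nonneg_nonneg)
    next
      case False
      then have "2 * B * 1 \<le> 2 * B * (dist z w / d)"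
        using B(1) d(1) by (intro mult_left_mono) (auto simp: field_simps)
      then show ?thesis using B(2)[OF zw(1)] B(2)[OF zw(2)] assms(3) by (simp add: abs_le_iff)
    qed
  qed (use B d in auto)
qed

lemma compact_upper_triangle: "compact upper_triangle"
proof (rule compact_eq_bounded_closed[THEN iffD2, OF conjI[OF _ closed_upper_triangle]])
  show "bounded upper_triangle"
    by (rule bounded_subset[of "{0..1} \<times> {0..1}"]) (auto simp: upper_triangle_def intro: bounded_Times)
qed

lemma dist_Pair_le: "dist (a, b) (c, d) \<le> \<bar>a - c\<bar> + \<bar>b - d\<bar>" for a b c d :: real
  unfolding dist_Pair_Pair dist_real_def using sqrt_sum_squares_le_sum_abs[of "a - c" "b - d"] by simp

text \<open>A central arc \<open>(i, j)\<close> is paired with the strip of width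
  \<open>1 / n\<close> ending at \<open>i / n\<close>: the integrals over its cell and over the
  strip are both compared with \<open>f (i / n, 1 - i / n) / n\<close>. Noncentral arcs and unpaired
  strips cost at most \<open>B / n\<close> each, and there are at most
  \<open>misplaced n \<pi>\<close> of each kind.\<close>

lemma integral_partition_measure_near_Omega:
  fixes f :: "real \<times> real \<Rightarrow> real"
  assumes \<pi>: "\<pi> \<in> set_partitions n" and n: "n \<ge> 1" and f: "continuous_on upper_triangle f"
    and B: "\<And>z. z \<in> upper_triangle \<Longrightarrow> \<bar>f z\<bar> \<le> B"
    and \<epsilon>: "0 \<le> \<epsilon>" and K: "0 \<le> K"
    and unif: "\<And>z w. z \<in> upper_triangle \<Longrightarrow> w \<in> upper_triangle \<Longrightarrow> \<bar>f z - f w\<bar> \<le> \<epsilon> + K * dist z w"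
  shows "\<bar>(\<integral>z. f z \<partial>partition_measure n \<pi>) - (\<integral>z. f z \<partial>Omega)\<bar> \<le>
    2 * \<epsilon> + (K + 2 * B) * (real (misplaced n \<pi>) / n) + 2 * K * (real (crs \<pi>) / real n ^ 2)
      + (4 * K + B) / n"
proof -
  define m where "m = n div 2"
  define g where "g = (\<lambda>x. f (x, 1 - x))"
  define a where "a = (\<lambda>(i, j). n * (LINT z:cell n i j|lborel. f z))"
  define b where "b = (\<lambda>i. integral {(real i - 1) / n .. real i / n} g)"
  let ?D = "arcs \<pi>" and ?G = "central_arcs n \<pi>" and ?w = "real (misplaced n \<pi>)"
  let ?M = "{1..m} - fst ` ?G"
  note fin = finite_arcs[OF \<pi>] finite_central_arcs[OF \<pi>]
  have B0: "0 \<le> B" using B[of "(0, 0)"] by (auto simp: upper_triangle_def)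
  have tri: "(x, 1 - x) \<in> upper_triangle" if "x \<in> {0..1 / 2}" for x
    using that by (auto simp: upper_triangle_def)
  have cg: "continuous_on {0..1 / 2} g"
    unfolding g_def by (rule continuous_on_compose2[OF f]) (auto intro!: continuous_intros tri)
  have mn: "real m / n \<le> 1 / 2" using n by (simp add: m_def field_simps)
  have strip: "{(real i - 1) / n .. real i / n} \<subseteq> {0..1 / 2}" "real i / n \<in> {0..1 / 2}"
    if "i \<in> {1..m}" for i
  proof -
    have "real i / n \<le> real m / n" using that by (simp add: divide_right_mono)
    then have le: "real i / n \<le> 1 / 2" using mn by linarith
    moreover have "0 \<le> (real i - 1) / n" using that by simp
    ultimately show "{(real i - 1) / n .. real i / n} \<subseteq> {0..1 / 2}" by auto
    show "real i / n \<in> {0..1 / 2}" using le by auto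
  qed
  have width: "real i / n - (real i - 1) / n = 1 / n" for i
    by (simp add: diff_divide_distrib)
  \<comment> \<open>On the strip both coordinates of \<open>(x, 1 - x)\<close> move by at most
    \<open>1 / n\<close>, whence \<open>2 / n\<close>.\<close>
  have b_near: "\<bar>b i - f (i / n, 1 - i / n) / n\<bar> \<le> (\<epsilon> + K * (2 / n)) / n" if i: "i \<in> {1..m}" for i
  proof -
    have "\<bar>b i - (real i / n - (real i - 1) / n) * f (i / n, 1 - i / n)\<bar> \<le>
        (real i / n - (real i - 1) / n) * (\<epsilon> + K * (2 / n))"
      unfolding b_def
    proof (rule integral_interval_near_const)
      show "continuous_on {(real i - 1) / n .. real i / n} g"
        using cg strip(1)[OF i] by (rule continuous_on_subset)
      fix x assume x: "x \<in> {(real i - 1) / n .. real i / n}"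
      have "dist (x, 1 - x) (i / n, 1 - i / n) \<le> 2 * \<bar>x - i / n\<bar>"
        using dist_Pair_le[of x "1 - x" "i / n" "1 - i / n"] abs_minus_commute[of x "i / n"] by simp
      also have "\<dots> \<le> 2 / n" using x width[of i] by auto
      finally have "K * dist (x, 1 - x) (i / n, 1 - i / n) \<le> K * (2 / n)"
        using K by (rule mult_left_mono)
      moreover have "\<bar>g x - f (i / n, 1 - i / n)\<bar> \<le> \<epsilon> + K * dist (x, 1 - x) (i / n, 1 - i / n)"
        unfolding g_def using strip(1)[OF i] x strip(2)[OF i] by (intro unif tri) (rule subsetD)
      ultimately show "\<bar>g x - f (i / n, 1 - i / n)\<bar> \<le> \<epsilon> + K * (2 / n)" by linarith
    qed (simp add: divide_right_mono)
    then show ?thesis by (simp add: width)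
  qed
  have b_bound: "\<bar>b i\<bar> \<le> B / n" if i: "i \<in> {1..m}" for i
  proof -
    have "\<bar>b i - (real i / n - (real i - 1) / n) * 0\<bar> \<le> (real i / n - (real i - 1) / n) * B"
      unfolding b_def
    proof (rule integral_interval_near_const)
      show "continuous_on {(real i - 1) / n .. real i / n} g"
        using cg strip(1)[OF i] by (rule continuous_on_subset)
      fix x assume "x \<in> {(real i - 1) / n .. real i / n}"
      then have "x \<in> {0..1 / 2}" using strip(1)[OF i] by (rule rev_subsetD)
      then show "\<bar>g x - 0\<bar> \<le> B"
        using B[OF tri] by (simp add: g_def)
    qed (simp add: divide_right_mono)
    then show ?thesis by (simp add: width)
  qed
  have sub: "cell n i j \<subseteq> upper_triangle" if "(i, j) \<in> ?D" for i j
    using arcs_subset[OF \<pi> that] by (intro cell_subset_upper_triangle) auto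
  have a_bound: "\<bar>a e\<bar> \<le> B / n" if e: "e \<in> ?D" for e
    using set_integral_cell_near_const[of n "fst e" "snd e" f 0 B] n sub[of "fst e" "snd e"] e f B
    by (auto simp: a_def case_prod_beta intro: continuous_on_subset)
  have a_near: "\<bar>a (i, j) - f (i / n, 1 - i / n) / n\<bar> \<le>
      (\<epsilon> + K * ((\<bar>real n + 1 - i - j\<bar> + 2) / n)) / n" if e: "(i, j) \<in> ?G" for i j
    unfolding a_def prod.case
  proof (rule set_integral_cell_near_const[OF _ n])
    have ij: "(i, j) \<in> ?D" "i \<in> {1..m}"
      using e arcs_subset[OF \<pi>] by (auto simp: central_arcs_def m_def)
    show "continuous_on (cell n i j) f" using f sub[OF ij(1)] by (rule continuous_on_subset)
    fix z assume z: "z \<in> cell n i j"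
    then obtain x y where xy: "z = (x, y)" "x \<in> {(real i - 1) / n .. real i / n}"
        "y \<in> {(real j - 1) / n .. real j / n}"
      by (auto simp: cell_def)
    have x: "\<bar>x - i / n\<bar> \<le> 1 / n" using xy(2) width[of i] by auto
    \<comment> \<open>As \<open>n * y\<close> lies between \<open>j - 1\<close> and
      \<open>j\<close>, its distance to \<open>n - i\<close> is at most
      \<open>\<bar>n + 1 - i - j\<bar> + 1\<close>. The \<open>1 / n\<close> allowed for
      \<open>x\<close> turns the 1 into the 2 of \<open>a_near\<close>.\<close>
    have y: "\<bar>y - (1 - i / n)\<bar> \<le> (\<bar>real n + 1 - i - j\<bar> + 1) / n"
    proof -
      have "real j - 1 \<le> n * y" "n * y \<le> j" using xy(3) n by (auto simp: field_simps)
      then have "\<bar>n * y - (real n - i)\<bar> \<le> \<bar>real n + 1 - i - j\<bar> + 1" by linarith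
      moreover have "y - (1 - i / n) = (n * y - (real n - i)) / n" using n by (simp add: field_simps)
      ultimately show ?thesis by (simp add: divide_right_mono)
    qed
    have "dist z (i / n, 1 - i / n) \<le> (\<bar>real n + 1 - i - j\<bar> + 2) / n"
      using dist_Pair_le[of x y "i / n" "1 - i / n"] x y by (simp add: xy add_divide_distrib)
    then have "K * dist z (i / n, 1 - i / n) \<le> K * ((\<bar>real n + 1 - i - j\<bar> + 2) / n)"
      using K by (rule mult_left_mono)
    moreover have "\<bar>f z - f (i / n, 1 - i / n)\<bar> \<le> \<epsilon> + K * dist z (i / n, 1 - i / n)"
      using z sub[OF ij(1)] strip(2)[OF ij(2)] by (intro unif tri) auto
    ultimately show "\<bar>f z - f (i / n, 1 - i / n)\<bar> \<le> \<epsilon> + K * ((\<bar>real n + 1 - i - j\<bar> + 2) / n)"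
      by linarith
  qed
  have "card ?G \<le> n"
    using card_mono[OF fin(1) central_arcs_subset[of n]] card_arcs_le[OF \<pi>] by linarith
  have near: "\<bar>sum a ?G - sum b (fst ` ?G)\<bar> \<le>
      2 * \<epsilon> + K * (?w / n) + 2 * K * (real (crs \<pi>) / real n ^ 2) + 4 * K / n"
  proof -
    have "sum b (fst ` ?G) = (\<Sum>e\<in>?G. b (fst e))"
      using inj_on_subset[OF inj_on_fst_arcs[OF \<pi>] central_arcs_subset] by (simp add: sum.reindex)
    then have "\<bar>sum a ?G - sum b (fst ` ?G)\<bar> = \<bar>\<Sum>e\<in>?G. a e - b (fst e)\<bar>"
      by (simp add: sum_subtractf)
    also have "\<dots> \<le> (\<Sum>e\<in>?G. \<bar>a e - b (fst e)\<bar>)" by (rule sum_abs)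
    \<comment> \<open>The two errors of an arc are regrouped: the constant part is summed over at
      most \<open>n\<close> arcs, the distance part by
      \<open>sum_antidiagonal_distance\<close>.\<close>
    also have "\<dots> \<le> (\<Sum>(i, j)\<in>?G. (2 * \<epsilon> + 4 * K / n) / n + K / real n ^ 2 * \<bar>real n + 1 - i - j\<bar>)"
    proof (rule sum_mono, safe)
      fix i j assume e: "(i, j) \<in> ?G"
      then have "i \<in> {1..m}" using arcs_subset[OF \<pi>] by (auto simp: central_arcs_def m_def)
      then have "\<bar>a (i, j) - b i\<bar> \<le>
          (\<epsilon> + K * ((\<bar>real n + 1 - i - j\<bar> + 2) / n)) / n + (\<epsilon> + K * (2 / n)) / n"
        using a_near[OF e] b_near[of i] by linarith
      also have "\<dots> = (2 * \<epsilon> + 4 * K / n) / n + K / real n ^ 2 * \<bar>real n + 1 - i - j\<bar>"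
        using n by (simp add: field_simps power2_eq_square)
      finally show "\<bar>a (i, j) - b (fst (i, j))\<bar> \<le> \<dots>" by simp
    qed
    also have "\<dots> = card ?G * ((2 * \<epsilon> + 4 * K / n) / n) +
        K / real n ^ 2 * (\<Sum>(i, j)\<in>?G. \<bar>real n + 1 - i - j\<bar>)"
      by (simp add: split_def sum.distrib sum_distrib_left)
    also have "\<dots> \<le> n * ((2 * \<epsilon> + 4 * K / n) / n) + K / real n ^ 2 * (n * ?w + 2 * crs \<pi>)"
      using \<open>card ?G \<le> n\<close> \<epsilon> K sum_antidiagonal_distance[OF \<pi>]
      by (intro add_mono mult_mono mult_left_mono) auto
    also have "\<dots> = 2 * \<epsilon> + K * (?w / n) + 2 * K * (real (crs \<pi>) / real n ^ 2) + 4 * K / n"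
      using n by (simp add: field_simps power2_eq_square)
    finally show ?thesis .
  qed
  have off: "\<bar>sum a (?D - ?G)\<bar> \<le> B * (?w / n)"
  proof -
    have "\<bar>sum a (?D - ?G)\<bar> \<le> (\<Sum>e\<in>?D - ?G. B / n)"
      by (intro order_trans[OF sum_abs] sum_mono a_bound) auto
    also have "\<dots> = B / n * card (?D - ?G)" by simp
    also have "\<dots> \<le> B / n * ?w"
      using card_noncentral_arcs[OF \<pi>] B0 by (intro mult_left_mono) auto
    finally show ?thesis by simp
  qed
  have missing: "\<bar>sum b ?M\<bar> \<le> B * (?w / n)"
  proof -
    have "\<bar>sum b ?M\<bar> \<le> (\<Sum>i\<in>?M. B / n)"
      by (intro order_trans[OF sum_abs] sum_mono b_bound) auto
    also have "\<dots> = B / n * card ?M" by simp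
    also have "\<dots> \<le> B / n * ?w"
      using card_uncovered_left[OF \<pi>] B0 by (intro mult_left_mono) (auto simp: m_def)
    finally show ?thesis by simp
  qed
  \<comment> \<open>For odd \<open>n\<close> the strips stop at \<open>m / n\<close>, which is
    \<open>1 / (2 * n)\<close> short of \<open>1 / 2\<close>.\<close>
  have rest: "\<bar>integral {real m / n .. 1 / 2} g\<bar> \<le> B / n"
  proof -
    have "\<bar>integral {real m / n .. 1 / 2} g - (1 / 2 - real m / n) * 0\<bar> \<le> (1 / 2 - real m / n) * B"
    proof (rule integral_interval_near_const[OF mn])
      have sub: "{real m / n .. 1 / 2} \<subseteq> {0..1 / 2}" by simp
      show "continuous_on {real m / n .. 1 / 2} g" using cg sub by (rule continuous_on_subset)
      fix x assume "x \<in> {real m / n .. 1 / 2}"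
      then have "x \<in> {0..1 / 2}" using sub by (rule rev_subsetD)
      then show "\<bar>g x - 0\<bar> \<le> B" using B[OF tri] by (simp add: g_def)
    qed
    also have "1 / 2 - real m / n \<le> 1 / n"
    proof -
      have "real n \<le> 2 * real m + 1" unfolding m_def by linarith
      then have "(real n / 2 - m) / n \<le> 1 / n" by (intro divide_right_mono) auto
      then show ?thesis using n by (simp add: diff_divide_distrib)
    qed
    then have "(1 / 2 - real m / n) * B \<le> 1 / n * B" using B0 by (rule mult_right_mono)
    finally show ?thesis by simp
  qed
  have "(\<integral>z. f z \<partial>partition_measure n \<pi>) = sum a ?D"
    unfolding a_def by (rule integral_partition_measure[OF \<pi> n f])
  also have "\<dots> = sum a ?G + sum a (?D - ?G)"
    using sum.subset_diff[OF central_arcs_subset fin(1), of a n] by simp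
  finally have 1: "(\<integral>z. f z \<partial>partition_measure n \<pi>) = sum a ?G + sum a (?D - ?G)" .
  have "(\<integral>z. f z \<partial>Omega) = integral {0..1 / 2} g"
    unfolding g_def by (rule integral_Omega[OF f])
  also have "\<dots> = integral {0..real m / n} g + integral {real m / n .. 1 / 2} g"
    using mn cg
    by (intro Henstock_Kurzweil_Integration.integral_combine[symmetric] integrable_continuous_real) auto
  also have "integral {0..real m / n} g = sum b {1..m}"
    unfolding b_def using mn n
    by (intro integral_equidistant_split[symmetric] continuous_on_subset[OF cg]) auto
  also have "\<dots> = sum b (fst ` ?G) + sum b ?M"
  proof -
    have "fst ` ?G \<subseteq> {1..m}"
      using arcs_subset[OF \<pi>] by (force simp: central_arcs_def m_def)
    from sum.subset_diff[OF this, of b] show ?thesis by simp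
  qed
  finally have 2: "(\<integral>z. f z \<partial>Omega) =
      sum b (fst ` ?G) + sum b ?M + integral {real m / n .. 1 / 2} g" .
  have "\<bar>(\<integral>z. f z \<partial>partition_measure n \<pi>) - (\<integral>z. f z \<partial>Omega)\<bar> \<le>
      \<bar>sum a ?G - sum b (fst ` ?G)\<bar> + \<bar>sum a (?D - ?G)\<bar> + \<bar>sum b ?M\<bar> +
      \<bar>integral {real m / n .. 1 / 2} g\<bar>"
    unfolding 1 2 by linarith
  also have "\<dots> \<le> (2 * \<epsilon> + K * (?w / n) + 2 * K * (real (crs \<pi>) / real n ^ 2) + 4 * K / n) +
      B * (?w / n) + B * (?w / n) + B / n"
    by (intro add_mono near off missing rest)
  also have "\<dots> = 2 * \<epsilon> + (K + 2 * B) * (?w / n) + 2 * K * (real (crs \<pi>) / real n ^ 2) + (4 * K + B) / n"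
    by (simp add: distrib_right add_divide_distrib)
  finally show ?thesis .
qed

section \<open>Concentration of the superplancherel measure\<close>

text \<open>Up to a factor \<open>q\<^bsup>O(n)\<^esup>\<close>, the weight of \<open>\<pi>\<close> is \<open>q\<close> to the power \<open>- deficit n \<pi>\<close>.\<close>

definition deficit :: "nat \<Rightarrow> nat set set \<Rightarrow> real" where
  "deficit n \<pi> = real (crs \<pi>) + real n * (real n - 1) / 2 - 2 * real (dimension \<pi>)"

section \<open>Small deficit implies weak* convergence\<close>

text \<open>The dimension never exceeds \<open>(n ^ 2 + 1) / 4\<close>, so a small deficit bounds
  the crossings and forces the dimension close to this maximum; lower-order terms are absorbed using
  \<open>n \<le> n powr (3 / 2)\<close>.\<close>

lemma misplaced_crs_le:
  assumes \<pi>: "\<pi> \<in> set_partitions n" and n: "n \<ge> 1" and t: "deficit n \<pi> \<le> real n powr (3 / 2)"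
  shows "real (misplaced n \<pi>) \<le> 9 * real n powr (3 / 4)" "real (crs \<pi>) \<le> 2 * real n powr (3 / 2)"
proof -
  let ?w = "real (misplaced n \<pi>)" and ?r = "real n powr (3 / 4)"
  have r: "1 \<le> ?r" using n by (simp add: ge_one_powr_ge_zero)
  have r2: "real n powr (3 / 2) = ?r * ?r" by (simp flip: powr_add)
  have "real n powr 1 \<le> real n powr (3 / 2)" using n by (intro powr_mono) auto
  then have nr: "real n \<le> real n powr (3 / 2)" by simp
  have dim: "2 * real (dimension \<pi>) \<ge> real (crs \<pi>) + real n ^ 2 / 2 - real n / 2 - real n powr (3 / 2)"
    using t by (simp add: deficit_def power2_eq_square field_simps)
  have "2 * real (dimension \<pi>) \<le> (real n ^ 2 + 1) / 2"
    using misplaced_le_deficit[OF \<pi>, of 0] by simp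
  then show "real (crs \<pi>) \<le> 2 * real n powr (3 / 2)"
    using dim nr n by simp
  \<comment> \<open>This order of \<open>k\<close> balances \<open>k ^ 2\<close> against the missing
    dimension, of order \<open>n powr (3 / 2)\<close>.\<close>
  define k where "k = nat \<lceil>?r\<rceil>"
  have k: "?r \<le> k" "k \<le> ?r + 1" using r unfolding k_def by linarith+
  have "k * ?w \<le> 4 * real k ^ 2 + ((real n ^ 2 + 1) / 4 - dimension \<pi>)"
    using misplaced_le_deficit[OF \<pi>, of k] by simp
  also have "(real n ^ 2 + 1) / 4 - dimension \<pi> \<le> real n powr (3 / 2)"
    using dim nr n by (simp add: field_simps)
  also have "real n powr (3 / 2) \<le> k * ?r"
    unfolding r2 using k(1) r by (intro mult_right_mono) auto
  finally have "k * ?w \<le> k * (4 * k + ?r)" by (simp add: power2_eq_square algebra_simps)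
  then have "?w \<le> 4 * k + ?r" using k(1) r by simp
  \<comment> \<open>\<open>4 * k + ?r \<le> 5 * ?r + 4\<close>, and
    \<open>1 \<le> ?r\<close>.\<close>
  then show "?w \<le> 9 * ?r" using k(2) r by linarith
qed

lemma weak_star_convergent_if_deficit_small:
  assumes small: "\<forall>\<^sub>F n in sequentially. \<pi> n \<in> set_partitions n \<and> deficit n (\<pi> n) \<le> real n powr (3 / 2)"
  shows "weak_star_convergent (\<lambda>n. partition_measure n (\<pi> n)) Omega"
  unfolding weak_star_convergent_def
proof (intro allI impI, elim conjE)
  fix f :: "real \<times> real \<Rightarrow> real"
  assume f: "continuous_on upper_triangle f" and "bounded (f ` upper_triangle)"
  then obtain B where B: "B > 0" "\<And>z. z \<in> upper_triangle \<Longrightarrow> \<bar>f z\<bar> \<le> B"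
    by (auto simp: bounded_pos)
  show "(\<lambda>n. \<integral>z. f z \<partial>partition_measure n (\<pi> n)) \<longlonglongrightarrow> (\<integral>z. f z \<partial>Omega)"
  proof (rule tendstoI)
    fix e :: real assume e: "e > 0"
    then obtain K where K: "K \<ge> 0"
      "\<And>z w. z \<in> upper_triangle \<Longrightarrow> w \<in> upper_triangle \<Longrightarrow> \<bar>f z - f w\<bar> \<le> e / 3 + K * dist z w"
      using uniform_continuity_affine_bound[OF compact_upper_triangle f, of "e / 3"] by auto
    \<comment> \<open>The bounds of \<open>misplaced_crs_le\<close> are inserted; the three terms
      have orders \<open>n powr (-1/4)\<close>, \<open>n powr (-1/2)\<close> and
      \<open>1 / n\<close>. The modulus \<open>e / 3\<close> enters twice, which leaves
      \<open>e / 3\<close> for \<open>err\<close>.\<close>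
    define err where "err = (\<lambda>n. (K + 2 * B) * (9 * real n powr (3 / 4) / n) +
      2 * K * (2 * real n powr (3 / 2) / real n ^ 2) + (4 * K + B) / n)"
    have "err \<longlonglongrightarrow> 0" unfolding err_def by real_asymp
    then have "\<forall>\<^sub>F n in sequentially. err n < e / 3"
      using e by (intro order_tendstoD(2)) auto
    with small eventually_ge_at_top[of 1]
    show "\<forall>\<^sub>F n in sequentially. dist (\<integral>z. f z \<partial>partition_measure n (\<pi> n)) (\<integral>z. f z \<partial>Omega) < e"
    proof eventually_elim
      case (elim n)
      then have \<pi>: "\<pi> n \<in> set_partitions n" and n: "n \<ge> 1" by auto
      note le = misplaced_crs_le[OF \<pi> n conjunct2[OF elim(1)]]
      have "dist (\<integral>z. f z \<partial>partition_measure n (\<pi> n)) (\<integral>z. f z \<partial>Omega) \<le>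
          2 * (e / 3) + (K + 2 * B) * (real (misplaced n (\<pi> n)) / n) +
          2 * K * (real (crs (\<pi> n)) / real n ^ 2) + (4 * K + B) / n"
        unfolding dist_real_def
        by (rule integral_partition_measure_near_Omega[OF \<pi> n f B(2) _ K]) (use e in auto)
      also have "\<dots> \<le> 2 * (e / 3) + err n"
        unfolding err_def add.assoc
        by (intro add_mono mult_left_mono divide_right_mono le) (use K(1) B(1) in auto)
      also have "\<dots> < e" using elim by simp
      finally show ?case .
    qed
  qed
qed

section \<open>Counting partitions and the tail of the deficit\<close>

text \<open>Every partition is the kernel of a self-map of \<open>{1..n}\<close>, namely of the one
  that sends each point to the least element of its block.\<close>

lemma
  shows finite_set_partitions: "finite (set_partitions n)"
    and card_set_partitions_le: "card (set_partitions n) \<le> n ^ n"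
proof -
  let ?F = "{1..n} \<rightarrow>\<^sub>E {1..n}"
  let ?kernel = "\<lambda>f :: nat \<Rightarrow> nat. (\<lambda>i. {j \<in> {1..n}. f j = f i}) ` {1..n}"
  have sub: "set_partitions n \<subseteq> ?kernel ` ?F"
  proof
    fix \<pi> assume "\<pi> \<in> set_partitions n"
    then have \<pi>: "\<Union>\<pi> = {1..n}" "\<And>A B. A \<in> \<pi> \<Longrightarrow> B \<in> \<pi> \<Longrightarrow> A \<noteq> B \<Longrightarrow> A \<inter> B = {}" "{} \<notin> \<pi>"
      by (auto simp: set_partitions_def partition_on_def disjoint_def)
    define blk where "blk i = (THE A. A \<in> \<pi> \<and> i \<in> A)" for i
    have blk: "blk i = A" if "A \<in> \<pi>" "i \<in> A" for A i
      unfolding blk_def using that \<pi>(2) by (intro the_equality) blast+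
    define f where "f = restrict (\<lambda>i. Min (blk i)) {1..n}"
    have fin: "finite A" if "A \<in> \<pi>" for A
      using that \<pi>(1) by (intro finite_subset[of A "{1..n}"]) auto
    have Min_in: "Min A \<in> A" if "A \<in> \<pi>" for A
      using fin[OF that] that \<pi>(3) by (intro Min_in) auto
    have f: "f i = Min A" if "A \<in> \<pi>" "i \<in> A" for A i
      using that blk[OF that] \<pi>(1) unfolding f_def by auto
    have "f \<in> ?F"
    proof (rule PiE_I)
      fix i assume "i \<in> {1..n}"
      then obtain A where A: "A \<in> \<pi>" "i \<in> A" using \<pi>(1) by blast
      then show "f i \<in> {1..n}" using f[OF A] Min_in[OF A(1)] \<pi>(1) by auto
    qed (use f_def in auto)
    have fibre: "{j \<in> {1..n}. f j = f i} = A" if A: "A \<in> \<pi>" "i \<in> A" for A i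
    proof (intro equalityI subsetI)
      fix j assume "j \<in> {j \<in> {1..n}. f j = f i}"
      then obtain A' where A': "A' \<in> \<pi>" "j \<in> A'" "f j = f i" using \<pi>(1) by blast
      then have "Min A' = Min A" using f A by metis
      then have "A' = A" using Min_in A A' \<pi>(2) by (metis disjoint_iff)
      then show "j \<in> A" using A' by simp
    next
      fix j assume "j \<in> A"
      then show "j \<in> {j \<in> {1..n}. f j = f i}" using f A \<pi>(1) by auto
    qed
    have "\<pi> = ?kernel f"
    proof (intro equalityI subsetI)
      fix A assume A: "A \<in> \<pi>"
      then obtain i where "i \<in> A" using \<pi>(3) by (metis all_not_in_conv)
      then show "A \<in> ?kernel f" using fibre[OF A] A \<pi>(1) by blast
    next
      fix A assume "A \<in> ?kernel f"
      then obtain i where i: "i \<in> {1..n}" "A = {j \<in> {1..n}. f j = f i}" by blast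
      then obtain A' where "A' \<in> \<pi>" "i \<in> A'" using \<pi>(1) by blast
      then show "A \<in> \<pi>" using fibre i(2) by simp
    qed
    with \<open>f \<in> ?F\<close> show "\<pi> \<in> ?kernel ` ?F" by blast
  qed
  have fin: "finite ?F" by (intro finite_PiE) auto
  show "finite (set_partitions n)" using sub fin by (meson finite_surj)
  have "card (set_partitions n) \<le> card ?F" using sub fin by (rule surj_card_le[rotated])
  also have "\<dots> = n ^ n" by (simp add: card_PiE)
  finally show "card (set_partitions n) \<le> n ^ n" .
qed

lemma SPl_nonneg: "1 < q \<Longrightarrow> 0 \<le> SPl q n \<pi>"
  by (simp add: SPl_eq)

text \<open>The factor \<open>(q - 1) ^ d\<close> is at most \<open>q ^ d\<close> and is absorbed by
  the \<open>- 2 * d\<close> in the exponent, with \<open>d\<close> the number of arcs. What remains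
  is \<open>q\<close> to the power \<open>- deficit n \<pi>\<close>.\<close>

lemma SPl_le_deficit:
  assumes q: "1 < q" and t: "0 \<le> t" "t \<le> deficit n \<pi>"
  shows "SPl q n \<pi> \<le> 2 powr (- t)"
proof -
  let ?N = "n * (n - 1) div 2" and ?d = "num_arcs \<pi>" and ?D = "dimension \<pi>"
  \<comment> \<open>The integer division is exact because \<open>n * (n - 1)\<close> is
    even.\<close>
  have N: "real ?N = real n * (real n - 1) / 2"
  proof -
    have "even (n * (n - 1))" by auto
    then have "n * (n - 1) = 2 * ?N" by simp
    then have "real (n * (n - 1)) = 2 * real ?N" by (metis of_nat_mult of_nat_numeral)
    moreover have "real (n * (n - 1)) = real n * (real n - 1)" by (cases n) (simp_all add: algebra_simps)
    ultimately show ?thesis by linarith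
  qed
  have "(real q - 1) ^ ?d * real q ^ (2 * ?D - 2 * ?d) \<le> real q ^ ?d * real q ^ (2 * ?D - 2 * ?d)"
    using q by (intro mult_right_mono power_mono) auto
  also have "\<dots> \<le> real q ^ (2 * ?D)"
    unfolding power_add[symmetric] using q num_arcs_le_dimension[of \<pi>]
    by (intro power_increasing) auto
  finally have "SPl q n \<pi> \<le> 1 / real q ^ ?N * (real q ^ (2 * ?D) / real q ^ crs \<pi>)"
    unfolding SPl_eq[OF q] using q by (intro mult_left_mono divide_right_mono) auto
  also have "\<dots> = real q powr (real (2 * ?D) - real (crs \<pi>) - real ?N)"
    using q by (simp only: powr_diff powr_realpow) simp
  also have "real (2 * ?D) - real (crs \<pi>) - real ?N = - deficit n \<pi>"
    unfolding N deficit_def by simp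
  also have "real q powr (- deficit n \<pi>) \<le> real q powr (- t)"
    using q t by (intro powr_mono) auto
  \<comment> \<open>The exponent is at most 0, so lowering the base to 2 enlarges the power and
    makes the bound independent of \<open>q\<close>.\<close>
  also have "\<dots> \<le> 2 powr (- t)"
    using q t by (intro powr_mono2') auto
  finally show ?thesis .
qed

text \<open>Union bound: the largest weight in the event times the number of all partitions.\<close>

lemma measure_superplancherel_large_deficit:
  assumes q: "1 < q" and t: "0 \<le> t"
  shows "measure (superplancherel q n) {\<pi> \<in> set_partitions n. t < deficit n \<pi>} \<le> real n ^ n * 2 powr (- t)"
proof -
  let ?S = "{\<pi> \<in> set_partitions n. t < deficit n \<pi>}"
  have "emeasure (superplancherel q n) ?S = (\<Sum>\<pi>\<in>?S. ennreal (SPl q n \<pi>))"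
    unfolding superplancherel_def
    by (rule emeasure_point_measure_finite) (auto simp: finite_set_partitions)
  also have "\<dots> = ennreal (\<Sum>\<pi>\<in>?S. SPl q n \<pi>)"
    using SPl_nonneg[OF q] by (intro sum_ennreal) auto
  finally have "measure (superplancherel q n) ?S = (\<Sum>\<pi>\<in>?S. SPl q n \<pi>)"
    using SPl_nonneg[OF q] by (simp add: measure_def sum_nonneg)
  also have "\<dots> \<le> (\<Sum>\<pi>\<in>?S. 2 powr (- t))"
    using SPl_le_deficit[OF q t] by (intro sum_mono) auto
  also have "\<dots> = card ?S * 2 powr (- t)" by simp
  also have "card ?S \<le> n ^ n"
    by (rule order_trans[OF card_mono card_set_partitions_le]) (auto simp: finite_set_partitions)
  then have "card ?S * 2 powr (- t) \<le> real n ^ n * 2 powr (- t)"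
    by (intro mult_right_mono) (simp_all flip: of_nat_power)
  finally show ?thesis .
qed

text \<open>The logarithm of \<open>n ^ n\<close> is \<open>n * ln n\<close>, of lower order than
  \<open>n powr (3 / 2)\<close>, so the terms decay faster than a geometric sequence.\<close>

lemma summable_power_self_times_powr:
  "summable (\<lambda>n. real n ^ n * 2 powr (- (real n powr (3 / 2))))"
proof (rule summable_comparison_test_bigo)
  show "summable (\<lambda>n. norm ((1 / 2) ^ n :: real))" by (simp add: summable_geometric)
  have "(\<lambda>n. real n powr n * 2 powr (- (real n powr (3 / 2)))) \<in> O(\<lambda>n. (1 / 2) ^ n)"
    by real_asymp
  \<comment> \<open>The two powers agree only for \<open>n > 0\<close>: \<open>0 powr 0 = 0\<close>,
    whereas \<open>0 ^ 0 = 1\<close>.\<close>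
  also have "?this \<longleftrightarrow> (\<lambda>n. real n ^ n * 2 powr (- (real n powr (3 / 2)))) \<in> O(\<lambda>n. (1 / 2) ^ n)"
    by (intro landau_o.big.in_cong eventually_mono[OF eventually_gt_at_top[of 0]]) (simp add: powr_realpow)
  finally show "(\<lambda>n. real n ^ n * 2 powr (- (real n powr (3 / 2)))) \<in> O(\<lambda>n. (1 / 2) ^ n)" .
qed

section \<open>Almost sure convergence by Borel-Cantelli\<close>

theorem theorem1p1:
  fixes q :: nat
    and M :: "'a measure"
    and X :: "nat \<Rightarrow> 'a \<Rightarrow> nat set set"
  assumes "primepow q"
    and "prob_space M"
    and "\<And>n. n \<ge> 1 \<Longrightarrow> X n \<in> measurable M (superplancherel q n)"
    and "\<And>n. n \<ge> 1 \<Longrightarrow> distr M (superplancherel q n) (X n) = superplancherel q n"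
  shows "AE \<omega> in M. weak_star_convergent (\<lambda>n. partition_measure n (X n \<omega>)) Omega"
proof -
  interpret prob_space M by fact
  have q: "1 < q" using primepow_gt_Suc_0[OF assms(1)] by simp
  define S where "S n = {\<pi> \<in> set_partitions n. real n powr (3 / 2) < deficit n \<pi>}" for n
  \<comment> \<open>The law of \<open>X n\<close> is prescribed from \<open>n = 1\<close> on, so the
    events are indexed by \<open>Suc n\<close>; the shift is undone at the end, where only eventual
    statements matter.\<close>
  define A where "A n = X (Suc n) -` S (Suc n) \<inter> space M" for n
  have S: "S n \<in> sets (superplancherel q n)" for n
    by (auto simp: S_def superplancherel_def sets_point_measure)
  have space: "X n \<omega> \<in> set_partitions n" if "\<omega> \<in> space M" "n \<ge> 1" for n \<omega>
    using measurable_space[OF assms(3)[OF that(2)] that(1)]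
    by (simp add: superplancherel_def space_point_measure)
  have "measure M (A n) = measure (superplancherel q (Suc n)) (S (Suc n))" for n
    using measure_distr[OF assms(3)[of "Suc n"] S] assms(4)[of "Suc n"] by (simp add: A_def)
  then have le: "measure M (A n) \<le> real (Suc n) ^ Suc n * 2 powr (- (real (Suc n) powr (3 / 2)))" for n
    unfolding S_def by (metis measure_superplancherel_large_deficit[OF q] powr_ge_zero)
  have "summable (\<lambda>n. measure M (A n))"
    by (rule summable_comparison_test_ev[OF _ summable_power_self_times_powr[THEN summable_Suc_iff[THEN iffD2]]])
      (use le in \<open>auto intro!: always_eventually\<close>)
  moreover have "A n \<in> sets M" for n
    unfolding A_def using assms(3) S by (intro measurable_sets) auto
  \<comment> \<open>Summable probabilities suffice here, whatever the joint law of the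
    \<open>X n\<close>.\<close>
  ultimately have "AE \<omega> in M. \<forall>\<^sub>F n in sequentially. \<omega> \<in> space M - A n"
    by (intro borel_cantelli_AE1) (auto simp: emeasure_eq_measure)
  then show ?thesis
  proof eventually_elim
    case (elim \<omega>)
    then have "\<forall>\<^sub>F n in sequentially. X (Suc n) \<omega> \<in> set_partitions (Suc n) \<and>
        deficit (Suc n) (X (Suc n) \<omega>) \<le> real (Suc n) powr (3 / 2)"
      by eventually_elim (auto simp: A_def S_def space not_less)
    then show ?case
      by (intro weak_star_convergent_if_deficit_small) (subst (asm) eventually_sequentially_Suc)
  qed
qed

end
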